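(* Let $n\ge 1$, let $D\subset\mathbb{R}^n$ be open, and let $f,\nu:D\to\mathbb{R}^{n+2}\setminus\{0\}$ be smooth with $\langle f,\nu\rangle=0$, related by the projective Lelieuvre map for hypersurfaces with coefficient functions $A_{\alpha\beta}:D\to\mathbb{R}$ (the matrix $A=(A_{\alpha\beta})$ being invertible), i.e. $$f\wedge f_{x_\alpha}=\sum_{\beta=1}^nA_{\alpha\beta}\star\left(\nu_{x_1}\wedge\dots\wedge\nu_{x_{\beta-1}}\wedge\nu\wedge\nu_{x_{\beta+1}}\wedge\dots\wedge\nu_{x_n}\right),\quad \alpha=1,\dots,n.$$ Then for all $\alpha,\gamma\in\{1,\dots,n\}$, at every point of $D$ where $\det|\nu_{x_\alpha x_\gamma},\nu,\nu_{x_1},\dots,\nu_{x_n}|\neq0$, $$f=-\left(\frac{A_{\alpha\gamma}}{\det|\nu_{x_\alpha x_\gamma},\nu,\nu_{x_1},\dots,\nu_{x_n}|}\right)^{1/2}[\nu,\nu_{x_1},\dots,\nu_{x_n}],$$ where $(\cdot)^{1/2}$ denotes a suitably chosen one of the two real square roots.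
   Context: $f=(f_1,\dots,f_{n+2})$ and $\nu=(\nu_1,\dots,\nu_{n+2})$ are homogeneous coordinate vectors of hypersurfaces in $P^{n+1}$ and in the dual space $P_{n+1}$, depending on local coordinates $(x_1,\dots,x_n)$; subscripts $x_\alpha$ denote partial derivatives; $\langle f,\nu\rangle=\sum_if_i\nu_i$. $\varepsilon$ is the totally alternating symbol on $n+2$ indices with $\varepsilon_{12\dots n+2}=1$. In components, the defining equations of the map mean $$f_if_{k,x_\alpha}-f_kf_{i,x_\alpha}=\sum_{\beta=1}^nA_{\alpha\beta}\sum_{l_1,\dots,l_n}\varepsilon_{ikl_1\dots l_n}\,\nu_{l_1,x_1}\cdots\nu_{l_{\beta-1},x_{\beta-1}}\,\nu_{l_\beta}\,\nu_{l_{\beta+1},x_{\beta+1}}\cdots\nu_{l_n,x_n}$$ for $i,k=1,\dots,n+2$ and $\alpha=1,\dots,n$. For $a_1,\dots,a_{n+1}\in\mathbb{R}^{n+2}$, $[a_1,\dots,a_{n+1}]_i=\sum\varepsilon_{ij_1\dots j_{n+1}}(a_1)_{j_1}\cdots(a_{n+1})_{j_{n+1}}$. $\det|a_1,\dots,a_{n+2}|$ is the determinant of the matrix formed by the vectors. *)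

theory Defs
  imports "HOL-Analysis.Analysis"
begin

text \<open>
  The coordinates \<open>x\<^sub>1, \<dots>, x\<^sub>n\<close> are indexed by a finite type \<open>'n\<close> (hence \<open>n \<ge> 1\<close>).
  The \<open>n+2\<close> homogeneous coordinates are indexed by \<open>'n option option\<close>, where \<open>None\<close> and
  \<open>Some None\<close> play the role of the indices 1 and 2 and \<open>Some (Some \<alpha>)\<close> that of \<open>\<alpha> + 2\<close>.
  A tuple of indices \<open>(i, k, l\<^sub>1, \<dots>, l\<^sub>n)\<close> is then a self-map of the index type, written
  \<open>case_option i (case_option k l)\<close>, and likewise \<open>(i, j\<^sub>1, \<dots>, j\<^bsub>n+1\<^esub>)\<close> is
  \<open>case_option i j\<close> with \<open>j\<close> defined on \<open>'n option\<close>; the tuple \<open>(1, \<dots>, n+2)\<close> is the identity.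
\<close>

type_synonym 'n hvec = "real ^ 'n option option"

definition partial :: "'n::finite \<Rightarrow> (real ^ 'n \<Rightarrow> 'b::real_normed_vector) \<Rightarrow> real ^ 'n \<Rightarrow> 'b" where
  "partial \<alpha> F x = vector_derivative (\<lambda>t. F (x + t *\<^sub>R axis \<alpha> 1)) (at 0)"

text \<open>The following two notions are meant for open \<open>D\<close>, where they are the usual ones.\<close>

primrec Ck_on :: "nat \<Rightarrow> (real ^ 'n::finite) set \<Rightarrow> (real ^ 'n \<Rightarrow> 'b::real_normed_vector) \<Rightarrow> bool" where
  "Ck_on 0 D F \<longleftrightarrow> continuous_on D F"
| "Ck_on (Suc k) D F \<longleftrightarrow> F differentiable_on D \<and> (\<forall>\<alpha>. Ck_on k D (partial \<alpha> F))"

definition smooth_on :: "(real ^ 'n::finite) set \<Rightarrow> (real ^ 'n \<Rightarrow> 'b::real_normed_vector) \<Rightarrow> bool" where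
  "smooth_on D F \<longleftrightarrow> (\<forall>k. Ck_on k D F)"

text \<open>
  The totally alternating symbol: zero on tuples with a repeated index, the sign of the
  permutation otherwise; in particular it is 1 on the identity.
\<close>

definition alt_symbol :: "('i::finite \<Rightarrow> 'i) \<Rightarrow> real" where
  "alt_symbol p = (if bij p then of_int (sign p) else 0)"

text \<open>Bivectors are represented by their skew matrices of components with indices \<open>i, k\<close>.\<close>

definition wedge :: "real ^ 'i::finite \<Rightarrow> real ^ 'i \<Rightarrow> real ^ 'i ^ 'i" where
  "wedge a b = (\<chi> i k. a $ i * b $ k - a $ k * b $ i)"

text \<open>The components of \<open>\<star>(a\<^sub>1 \<and> \<dots> \<and> a\<^sub>n)\<close>.\<close>

definition star_wedge :: "('n::finite \<Rightarrow> 'n hvec) \<Rightarrow> real ^ 'n option option ^ 'n option option" where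
  "star_wedge a = (\<chi> i k. \<Sum>l\<in>UNIV.
     alt_symbol (case_option i (case_option k l)) * (\<Prod>\<beta>\<in>UNIV. a \<beta> $ l \<beta>))"

text \<open>The vector \<open>[a\<^sub>1, \<dots>, a\<^bsub>n+1\<^esub>]\<close>, the arguments being indexed by \<open>'n option\<close>.\<close>

definition bracket :: "('n::finite option \<Rightarrow> 'n hvec) \<Rightarrow> 'n hvec" where
  "bracket a = (\<chi> i. \<Sum>j\<in>UNIV. alt_symbol (case_option i j) * (\<Prod>r\<in>UNIV. a r $ j r))"

definition det_of :: "('n::finite option option \<Rightarrow> 'n hvec) \<Rightarrow> real" where
  "det_of a = det (\<chi> r. a r)"

definition lelieuvre_related ::
  "(real ^ 'n::finite) set \<Rightarrow> (real ^ 'n \<Rightarrow> real ^ 'n ^ 'n) \<Rightarrow>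
   (real ^ 'n \<Rightarrow> 'n hvec) \<Rightarrow> (real ^ 'n \<Rightarrow> 'n hvec) \<Rightarrow> bool" where
  "lelieuvre_related D A f \<nu> \<longleftrightarrow> (\<forall>x\<in>D. \<forall>\<alpha>.
     wedge (f x) (partial \<alpha> f x) =
     (\<Sum>\<beta>\<in>UNIV. A x $ \<alpha> $ \<beta> *\<^sub>R star_wedge ((\<lambda>\<delta>. partial \<delta> \<nu> x)(\<beta> := \<nu> x))))"

end

theory Submission
  imports Defs
begin

text \<open>
  Write \<open>b = [\<nu>, \<nu>\<^sub>1, \<dots>, \<nu>\<^sub>n]\<close> with \<open>\<nu>\<^sub>\<gamma>\<close> the partial derivatives. Contracting the Lelieuvre
  relation with \<open>\<nu>\<close> gives \<open>\<langle>f\<^sub>\<alpha>, \<nu>\<rangle> = 0\<close>, hence \<open>\<langle>f, \<nu>\<^sub>\<alpha>\<rangle> = 0\<close> by differentiating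
  \<open>\<langle>f, \<nu>\<rangle> = 0\<close>. Contracting it with \<open>\<nu>\<^sub>\<gamma>\<close> then gives \<open>\<langle>f\<^sub>\<alpha>, \<nu>\<^sub>\<gamma>\<rangle> f = - A\<^sub>\<alpha>\<^sub>\<gamma> b\<close>, and
  differentiating \<open>\<langle>f, \<nu>\<^sub>\<gamma>\<rangle> = 0\<close> turns this into \<open>p f = A\<^sub>\<alpha>\<^sub>\<gamma> b\<close> with
  \<open>p = \<langle>f, \<nu>\<^sub>\<alpha>\<^sub>\<gamma>\<rangle>\<close>; here the symmetry of second derivatives enters. If \<open>p\<close> were zero, \<open>f\<close>
  would be orthogonal to a basis. So \<open>f = c b\<close> with \<open>c p = A\<^sub>\<alpha>\<^sub>\<gamma>\<close>, and pairing with
  \<open>\<nu>\<^sub>\<alpha>\<^sub>\<gamma>\<close> yields \<open>p = c d\<close> for the determinant \<open>d\<close>, whence \<open>c\<^sup>2 = A\<^sub>\<alpha>\<^sub>\<gamma> / d\<close>.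
\<close>

section \<open>Determinants and the alternating products\<close>

text \<open>Splits the first index off a tuple. Applied once or twice, it matches the full sum in
  the determinant with the shorter sums in \<open>bracket\<close> and
  \<open>star_wedge\<close>.\<close>

lemma sum_case_option:
  "(\<Sum>p\<in>UNIV. g p) = (\<Sum>i\<in>UNIV. \<Sum>j\<in>UNIV. g (case_option i j))"
  for g :: "('a::finite option \<Rightarrow> 'b::finite) \<Rightarrow> 'c::comm_monoid_add"
proof -
  have "bij_betw (\<lambda>(i, j). case_option i j) (UNIV \<times> UNIV) (UNIV :: ('a option \<Rightarrow> 'b) set)"
  proof (rule bij_betw_byWitness[where f' = "\<lambda>p. (p None, p \<circ> Some)"])
    show "\<forall>a\<in>UNIV \<times> UNIV. (\<lambda>p. (p None, p \<circ> Some)) ((\<lambda>(i, j). case_option i j) a) = a"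
      by (auto simp: fun_eq_iff)
    show "\<forall>p\<in>UNIV. (\<lambda>(i, j). case_option i j) (p None, p \<circ> Some) = p"
      by (auto simp: fun_eq_iff split: option.split)
  qed auto
  then show ?thesis
    by (simp add: sum.cartesian_product sum.reindex_bij_betw[symmetric] case_prod_unfold)
qed

lemma prod_UNIV_option:
  "(\<Prod>r\<in>UNIV. g r) = g None * (\<Prod>r\<in>UNIV. g (Some r))"
  for g :: "'a::finite option \<Rightarrow> 'c::comm_monoid_mult"
  by (simp add: UNIV_option_conv prod.reindex)

text \<open>Since \<open>alt_symbol\<close> vanishes off the permutations, the Leibniz sum may run
  over all self-maps, a domain on which \<open>sum_case_option\<close> applies.\<close>

lemma det_of_expand: "det_of a = (\<Sum>p\<in>UNIV. alt_symbol p * (\<Prod>r\<in>UNIV. a r $ p r))"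
proof -
  have "det_of a = (\<Sum>p | p permutes UNIV. alt_symbol p * (\<Prod>r\<in>UNIV. a r $ p r))"
    by (simp add: det_of_def det_def alt_symbol_def permutes_bij)
  also have "\<dots> = (\<Sum>p\<in>UNIV. alt_symbol p * (\<Prod>r\<in>UNIV. a r $ p r))"
  proof (rule sum.mono_neutral_left)
    show "\<forall>p\<in>UNIV - {p. p permutes UNIV}. alt_symbol p * (\<Prod>r\<in>UNIV. a r $ p r) = 0"
      using bij_imp_permutes[where S = UNIV] by (auto simp: alt_symbol_def)
  qed simp_all
  finally show ?thesis .
qed

text \<open>This is Laplace expansion along row \<open>None\<close>: \<open>bracket\<close> is the
  generalized cross product.\<close>

lemma inner_bracket: "u \<bullet> bracket a = det_of (case_option u a)"
  by (simp add: det_of_expand sum_case_option prod_UNIV_option bracket_def inner_vec_def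
      sum_distrib_left mult_ac)

text \<open>Contracting the second index k with \<open>u\<close> fills the first slot of the bracket
  with \<open>u\<close>.\<close>

lemma star_wedge_mult_vector: "star_wedge a *v u = bracket (case_option u a)"
  by (simp add: vec_eq_iff star_wedge_def bracket_def matrix_vector_mult_def sum_case_option
      prod_UNIV_option sum_distrib_left mult_ac)

lemma det_of_transpose:
  assumes "r \<noteq> s"
  shows "det_of (a \<circ> Transposition.transpose r s) = - det_of a"
proof -
  have "det (\<chi> i. (\<chi> r. a r) $ Transposition.transpose r s i) =
      of_int (sign (Transposition.transpose r s)) * det (\<chi> r. a r)"
    by (rule det_permute_rows) (simp add: permutes_swap_id)
  with assms show ?thesis by (simp add: det_of_def sign_swap_id)
qed

lemma det_of_eq_0:
  assumes "r \<noteq> s" "a r = a s"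
  shows "det_of a = 0"
proof -
  have "a \<circ> Transposition.transpose r s = a"
    using assms(2) by (auto simp: fun_eq_iff Transposition.transpose_def)
  with det_of_transpose[OF assms(1), of a] show ?thesis by simp
qed

text \<open>Pairing with an arbitrary \<open>u\<close> reduces the claim to determinants, where the
  two slots move to \<open>Some r\<close> and \<open>Some s\<close>.\<close>

lemma bracket_transpose:
  assumes "r \<noteq> s"
  shows "bracket (a \<circ> Transposition.transpose r s) = - bracket a"
proof (rule vector_eq_ldot[THEN iffD1], intro allI)
  fix u
  have "case_option u (a \<circ> Transposition.transpose r s)
      = case_option u a \<circ> Transposition.transpose (Some r) (Some s)"
    by (auto simp: fun_eq_iff Transposition.transpose_def split: option.split)
  then show "u \<bullet> bracket (a \<circ> Transposition.transpose r s) = u \<bullet> - bracket a"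
    using assms by (simp add: inner_bracket det_of_transpose)
qed

lemma bracket_eq_0:
  assumes "r \<noteq> s" "a r = a s"
  shows "bracket a = 0"
proof (rule vector_eq_ldot[THEN iffD1], intro allI)
  fix u
  have "det_of (case_option u a) = 0"
    by (rule det_of_eq_0[of "Some r" "Some s"]) (use assms in auto)
  then show "u \<bullet> bracket a = u \<bullet> 0" by (simp add: inner_bracket)
qed

lemma star_wedge_replace_base: "star_wedge (v(\<beta> := v0)) *v v0 = 0"
  unfolding star_wedge_mult_vector by (rule bracket_eq_0[of None "Some \<beta>"]) auto

text \<open>For \<open>\<delta> = \<beta>\<close> the bracket has \<open>v0\<close> and
  \<open>v \<beta>\<close> in exchanged slots, hence the sign. Otherwise \<open>v \<delta>\<close>
  fills both slot \<open>None\<close> and slot \<open>Some \<delta>\<close>.\<close>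

lemma star_wedge_replace_direction:
  "star_wedge (v(\<beta> := v0)) *v v \<delta> = (if \<delta> = \<beta> then - bracket (case_option v0 v) else 0)"
proof (cases "\<delta> = \<beta>")
  case True
  have "case_option (v \<beta>) (v(\<beta> := v0)) = case_option v0 v \<circ> Transposition.transpose None (Some \<beta>)"
    by (auto simp: fun_eq_iff Transposition.transpose_def split: option.split)
  then show ?thesis
    using True by (simp add: star_wedge_mult_vector bracket_transpose)
next
  case False
  have "bracket (case_option (v \<delta>) (v(\<beta> := v0))) = 0"
    by (rule bracket_eq_0[of None "Some \<delta>"]) (use False in auto)
  then show ?thesis using False by (simp add: star_wedge_mult_vector)
qed

lemma wedge_mult_vector: "wedge a b *v u = (b \<bullet> u) *\<^sub>R a - (a \<bullet> u) *\<^sub>R b"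
  by (simp add: vec_eq_iff wedge_def matrix_vector_mult_def inner_vec_def sum_distrib_left
      sum_subtractf algebra_simps)

lemma orthogonal_to_rows_eq_0:
  assumes "det_of a \<noteq> 0" "\<And>r. u \<bullet> a r = 0"
  shows "u = 0"
proof -
  have "invertible (\<chi> r. a r)"
    using assms(1) by (simp add: det_of_def invertible_det_nz)
  moreover have "(\<chi> r. a r) *v u = 0"
    using assms(2) by (simp add: vec_eq_iff matrix_vector_mul_component row_def inner_commute)
  ultimately show ?thesis
    by (metis invertible_def matrix_left_invertible_ker)
qed

lemma sum_matrix_vector_mult:
  "(\<Sum>\<beta>\<in>S. M \<beta>) *v u = (\<Sum>\<beta>\<in>S. M \<beta> *v u)"
  for M :: "'a \<Rightarrow> real ^ 'm ^ 'k"
  by (induction S rule: infinite_finite_induct) (simp_all add: matrix_vector_mult_add_rdistrib)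

section \<open>Partial derivatives\<close>

text \<open>\<open>partial\<close> differentiates at parameter 0 only; the mean value theorem needs
  the derivative at every parameter \<open>s\<close> of a line with fixed base point.\<close>

lemma has_vector_derivative_partial_line:
  assumes "F differentiable at (y + s *\<^sub>R axis \<alpha> 1)"
  shows "((\<lambda>t. F (y + t *\<^sub>R axis \<alpha> 1)) has_vector_derivative
           partial \<alpha> F (y + s *\<^sub>R axis \<alpha> 1)) (at s)"
proof -
  let ?e = "axis \<alpha> 1" and ?z = "y + s *\<^sub>R axis \<alpha> 1"
  obtain F' where F': "(F has_derivative F') (at ?z)"
    using assms by (auto simp: differentiable_def)
  \<comment> \<open>Used twice: with base point \<open>?z\<close> and parameter 0 it evaluates
    \<open>partial\<close>, with \<open>y\<close> and \<open>s\<close> it gives the claim.\<close>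
  have line: "((\<lambda>t. F (w + t *\<^sub>R ?e)) has_vector_derivative F' ?e) (at t0)"
    if "w + t0 *\<^sub>R ?e = ?z" for w t0
  proof -
    have "((\<lambda>t. w + t *\<^sub>R ?e) has_vector_derivative ?e) (at t0)"
      by (auto intro!: derivative_eq_intros)
    moreover have "(F has_derivative F') (at (w + t0 *\<^sub>R ?e) within range (\<lambda>t. w + t *\<^sub>R ?e))"
      using F' that by (simp add: has_derivative_at_withinI)
    ultimately show ?thesis
      using vector_derivative_diff_chain_within[of "\<lambda>t. w + t *\<^sub>R ?e" ?e t0 UNIV F F']
      by (simp add: o_def)
  qed
  have "partial \<alpha> F ?z = F' ?e"
    unfolding partial_def by (rule vector_derivative_at, rule line) simp
  then show ?thesis using line[of y s] by simp
qed

lemma has_vector_derivative_partial: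
  assumes "F differentiable at x"
  shows "((\<lambda>t. F (x + t *\<^sub>R axis \<alpha> 1)) has_vector_derivative partial \<alpha> F x) (at 0)"
  using has_vector_derivative_partial_line[of F x 0 \<alpha>] assms by simp

lemma partial_inner:
  assumes "F differentiable at x" "G differentiable at x"
  shows "partial \<alpha> (\<lambda>y. F y \<bullet> G y) x = partial \<alpha> F x \<bullet> G x + F x \<bullet> partial \<alpha> G x"
proof -
  have "((\<lambda>t. F (x + t *\<^sub>R axis \<alpha> 1) \<bullet> G (x + t *\<^sub>R axis \<alpha> 1)) has_vector_derivative
      (F x \<bullet> partial \<alpha> G x + partial \<alpha> F x \<bullet> G x)) (at 0)"
    using bounded_bilinear.has_vector_derivative[OF bounded_bilinear_inner
        has_vector_derivative_partial[OF assms(1), of \<alpha>]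
        has_vector_derivative_partial[OF assms(2), of \<alpha>]]
    by simp
  from vector_derivative_at[OF this] show ?thesis by (simp add: partial_def)
qed

text \<open>Openness of \<open>D\<close> makes the parameters whose points lie in \<open>D\<close> a
  neighbourhood of 0, so only values on \<open>D\<close> matter.\<close>

lemma partial_eq_0:
  assumes "open D" "x \<in> D" "\<And>y. y \<in> D \<Longrightarrow> F y = 0"
  shows "partial \<alpha> F x = 0"
proof -
  have "open ((\<lambda>t::real. x + t *\<^sub>R axis \<alpha> 1) -` D)"
    by (rule open_vimage[OF assms(1)]) (intro continuous_intros)
  then have "((\<lambda>t. F (x + t *\<^sub>R axis \<alpha> 1)) has_vector_derivative 0) (at 0)"
    by (rule has_vector_derivative_transform_within_open[OF has_vector_derivative_const])
      (simp_all add: assms)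
  then show ?thesis by (simp add: partial_def vector_derivative_at)
qed

lemma inner_partial_eq:
  assumes "open D" "x \<in> D" "F differentiable_on D" "G differentiable_on D"
    and "\<And>y. y \<in> D \<Longrightarrow> F y \<bullet> G y = 0"
  shows "F x \<bullet> partial \<alpha> G x = - (partial \<alpha> F x \<bullet> G x)"
proof -
  have "partial \<alpha> F x \<bullet> G x + F x \<bullet> partial \<alpha> G x = 0"
    using partial_inner[of F x G \<alpha>] partial_eq_0[of D x "\<lambda>y. F y \<bullet> G y" \<alpha>] assms
    by (simp add: differentiable_on_eq_differentiable_at)
  then show ?thesis by linarith
qed

section \<open>Symmetry of second partial derivatives\<close>

text \<open>Applying the mean value theorem in both variables to the second difference quotient
  turns it into a value of the mixed derivative near the base point.\<close>

lemma second_difference: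
  fixes g :: "real \<Rightarrow> real \<Rightarrow> real"
  assumes "h > 0"
    and g1: "\<And>s t. \<bar>s\<bar> \<le> h \<Longrightarrow> \<bar>t\<bar> \<le> h \<Longrightarrow> ((\<lambda>s. g s t) has_real_derivative g1 s t) (at s)"
    and g12: "\<And>s t. \<bar>s\<bar> \<le> h \<Longrightarrow> \<bar>t\<bar> \<le> h \<Longrightarrow> ((\<lambda>t. g1 s t) has_real_derivative g12 s t) (at t)"
  shows "\<exists>s t. 0 < s \<and> s < h \<and> 0 < t \<and> t < h \<and>
           g h h - g h 0 - g 0 h + g 0 0 = h\<^sup>2 * g12 s t"
proof -
  have "\<exists>s. 0 < s \<and> s < h \<and> (g h h - g h 0) - (g 0 h - g 0 0) = (h - 0) * (g1 s h - g1 s 0)"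
    using \<open>h > 0\<close> by (intro MVT2) (auto intro!: DERIV_diff g1)
  then obtain s where s: "0 < s" "s < h"
    and 1: "(g h h - g h 0) - (g 0 h - g 0 0) = h * (g1 s h - g1 s 0)" by auto
  have "\<exists>t. 0 < t \<and> t < h \<and> g1 s h - g1 s 0 = (h - 0) * g12 s t"
    using \<open>h > 0\<close> s by (intro MVT2) (auto intro!: g12)
  then obtain t where "0 < t" "t < h" "g1 s h - g1 s 0 = h * g12 s t" by auto
  with s 1 show ?thesis
    by (intro exI[of _ s] exI[of _ t]) (simp add: power2_eq_square algebra_simps)
qed

lemma Ck_on_2_D:
  assumes "open D" "Ck_on 2 D F" "x \<in> D"
  shows "F differentiable at x" "partial \<alpha> F differentiable at x"
    "isCont (partial \<gamma> (partial \<alpha> F)) x"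
  using assms
  by (auto simp: numeral_2_eq_2 differentiable_on_eq_differentiable_at continuous_on_eq_continuous_at)

text \<open>The mean value theorem holds for real functions only, so everything is paired with a
  fixed \<open>u\<close>. Two displacements of length at most \<open>h\<close> stay within distance
  \<open>2 * h\<close> of \<open>x\<close>.\<close>

lemma partial_second_difference:
  fixes F :: "real ^ 'n::finite \<Rightarrow> 'b::real_inner"
  assumes "open D" "Ck_on 2 D F" "x \<in> D" "h > 0"
    and sub: "cball x (2 * h) \<subseteq> D"
  shows "\<exists>z\<in>cball x (2 * h).
    u \<bullet> (F (x + h *\<^sub>R axis \<alpha> 1 + h *\<^sub>R axis \<gamma> 1) - F (x + h *\<^sub>R axis \<alpha> 1)
         - F (x + h *\<^sub>R axis \<gamma> 1) + F x) = h\<^sup>2 * (u \<bullet> partial \<gamma> (partial \<alpha> F) z)"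
proof -
  let ?p = "\<lambda>s t. x + s *\<^sub>R axis \<alpha> 1 + t *\<^sub>R axis \<gamma> 1"
  have mem: "?p s t \<in> cball x (2 * h)" if "\<bar>s\<bar> \<le> h" "\<bar>t\<bar> \<le> h" for s t
  proof -
    have "norm (s *\<^sub>R axis \<alpha> (1::real) + t *\<^sub>R axis \<gamma> 1) \<le> \<bar>s\<bar> + \<bar>t\<bar>"
      by (rule order_trans[OF norm_triangle_ineq]) simp
    moreover have "dist x (?p s t) = norm (s *\<^sub>R axis \<alpha> (1::real) + t *\<^sub>R axis \<gamma> 1)"
      by (subst dist_commute) (simp add: dist_norm add.assoc)
    ultimately show ?thesis using that by simp
  qed
  \<comment> \<open>The variable being differentiated must stand in the last summand to fit
    \<open>has_vector_derivative_partial_line\<close>.\<close>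
  have swap: "?p s t = (x + t *\<^sub>R axis \<gamma> 1) + s *\<^sub>R axis \<alpha> 1" for s t
    by simp
  have inner_deriv: "((\<lambda>t. u \<bullet> G t) has_real_derivative u \<bullet> G') (at t)"
    if "(G has_vector_derivative G') (at t)" for G G' t
    using bounded_linear.has_vector_derivative[OF bounded_linear_inner_right that]
    by (simp add: has_real_derivative_iff_has_vector_derivative)
  have "\<exists>s t. 0 < s \<and> s < h \<and> 0 < t \<and> t < h \<and>
      u \<bullet> F (?p h h) - u \<bullet> F (?p h 0) - u \<bullet> F (?p 0 h) + u \<bullet> F (?p 0 0)
      = h\<^sup>2 * (u \<bullet> partial \<gamma> (partial \<alpha> F) (?p s t))"
  proof (rule second_difference[where ?g1.0 = "\<lambda>s t. u \<bullet> partial \<alpha> F (?p s t)"])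
    fix s t assume st: "\<bar>s\<bar> \<le> h" "\<bar>t\<bar> \<le> h"
    then have z: "?p s t \<in> D" using mem sub by blast
    show "((\<lambda>s. u \<bullet> F (?p s t)) has_real_derivative u \<bullet> partial \<alpha> F (?p s t)) (at s)"
      unfolding swap using Ck_on_2_D(1)[OF assms(1,2) z] unfolding swap
      by (intro inner_deriv has_vector_derivative_partial_line)
    show "((\<lambda>t. u \<bullet> partial \<alpha> F (?p s t)) has_real_derivative
        u \<bullet> partial \<gamma> (partial \<alpha> F) (?p s t)) (at t)"
      by (intro inner_deriv has_vector_derivative_partial_line Ck_on_2_D(2)[OF assms(1,2) z])
  qed fact
  then obtain s t where st: "0 < s" "s < h" "0 < t" "t < h"
    and "u \<bullet> F (?p h h) - u \<bullet> F (?p h 0) - u \<bullet> F (?p 0 h) + u \<bullet> F (?p 0 0)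
      = h\<^sup>2 * (u \<bullet> partial \<gamma> (partial \<alpha> F) (?p s t))" by blast
  with mem[of s t] show ?thesis
    by (intro bexI[of _ "?p s t"]) (auto simp: inner_diff_right inner_add_right)
qed

text \<open>The second difference is symmetric in the two directions, so both mixed derivatives
  share values at points of arbitrarily small balls around \<open>x\<close>; continuity carries the
  equality to \<open>x\<close>.\<close>

lemma partial_commute:
  fixes F :: "real ^ 'n::finite \<Rightarrow> 'b::real_inner"
  assumes "open D" "Ck_on 2 D F" "x \<in> D"
  shows "partial \<gamma> (partial \<alpha> F) x = partial \<alpha> (partial \<gamma> F) x"
proof (rule vector_eq_ldot[THEN iffD1], intro allI)
  fix u
  let ?G = "\<lambda>z. u \<bullet> partial \<gamma> (partial \<alpha> F) z" and ?H = "\<lambda>z. u \<bullet> partial \<alpha> (partial \<gamma> F) z"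
  obtain r where r: "r > 0" "cball x r \<subseteq> D"
    using assms open_contains_cball by blast
  \<comment> \<open>The factor \<open>r / 2\<close> keeps the balls of radius \<open>2 * h k\<close>
    inside \<open>cball x r\<close>, hence inside \<open>D\<close>.\<close>
  define h where "h = (\<lambda>k. r / 2 * inverse (real (Suc k)))"
  have h: "h k > 0" "2 * h k \<le> r" for k
    using r(1) by (auto simp: h_def field_simps)
  have h0: "(\<lambda>k. 2 * h k) \<longlonglongrightarrow> 0"
    using tendsto_mult_left[OF LIMSEQ_inverse_real_of_nat, of r] by (simp add: h_def)
  have "\<exists>y z. y \<in> cball x (2 * h k) \<and> z \<in> cball x (2 * h k) \<and> ?G y = ?H z" for k
  proof -
    have sub: "cball x (2 * h k) \<subseteq> D"
      using h(2)[of k] r(2) by (meson subset_cball order_trans)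
    let ?\<Delta> = "\<lambda>\<alpha> \<gamma>. u \<bullet> (F (x + h k *\<^sub>R axis \<alpha> 1 + h k *\<^sub>R axis \<gamma> 1)
      - F (x + h k *\<^sub>R axis \<alpha> 1) - F (x + h k *\<^sub>R axis \<gamma> 1) + F x)"
    obtain y where y: "y \<in> cball x (2 * h k)" "?\<Delta> \<alpha> \<gamma> = (h k)\<^sup>2 * ?G y"
      using partial_second_difference[OF assms h(1) sub, of u \<alpha> \<gamma>] by blast
    obtain z where z: "z \<in> cball x (2 * h k)" "?\<Delta> \<gamma> \<alpha> = (h k)\<^sup>2 * ?H z"
      using partial_second_difference[OF assms h(1) sub, of u \<gamma> \<alpha>] by blast
    have "?\<Delta> \<alpha> \<gamma> = ?\<Delta> \<gamma> \<alpha>" by (simp add: algebra_simps)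
    with y(2) z(2) h(1)[of k] have "?G y = ?H z" by simp
    with y(1) z(1) show ?thesis by blast
  qed
  then obtain y z where yz: "\<And>k. y k \<in> cball x (2 * h k)" "\<And>k. z k \<in> cball x (2 * h k)"
    "\<And>k. ?G (y k) = ?H (z k)" by metis
  have lim: "w \<longlonglongrightarrow> x" if "\<And>k. w k \<in> cball x (2 * h k)" for w
  proof (rule metric_tendsto_imp_tendsto[OF h0])
    have "dist (w k) x \<le> dist (2 * h k) 0" for k
      using that[of k] h(1)[of k] by (simp add: dist_commute)
    then show "\<forall>\<^sub>F k in sequentially. dist (w k) x \<le> dist (2 * h k) 0"
      by (rule always_eventually[OF allI])
  qed
  have "(\<lambda>k. ?G (y k)) \<longlonglongrightarrow> ?G x"
    by (rule tendsto_inner[OF tendsto_const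
        isCont_tendsto_compose[OF Ck_on_2_D(3)[OF assms] lim[OF yz(1)]]])
  moreover have "(\<lambda>k. ?H (z k)) \<longlonglongrightarrow> ?H x"
    by (rule tendsto_inner[OF tendsto_const
        isCont_tendsto_compose[OF Ck_on_2_D(3)[OF assms] lim[OF yz(2)]]])
  ultimately show "?G x = ?H x"
    unfolding yz(3) by (rule LIMSEQ_unique)
qed

section \<open>The formula for the hypersurface\<close>

theorem theorem4p1:
  fixes D :: "(real ^ 'n::finite) set"
    and f \<nu> :: "real ^ 'n \<Rightarrow> real ^ 'n option option"
    and A :: "real ^ 'n \<Rightarrow> real ^ 'n ^ 'n"
  assumes "open D"
    and "smooth_on D f" and "smooth_on D \<nu>"
    and "\<And>x. x \<in> D \<Longrightarrow> f x \<noteq> 0" and "\<And>x. x \<in> D \<Longrightarrow> \<nu> x \<noteq> 0"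
    and "\<And>x. x \<in> D \<Longrightarrow> f x \<bullet> \<nu> x = 0"
    and "\<And>x. x \<in> D \<Longrightarrow> invertible (A x)"
    and "lelieuvre_related D A f \<nu>"
  shows "\<forall>\<alpha> \<gamma>. \<forall>x\<in>D.
    let d = det_of (case_option (partial \<gamma> (partial \<alpha> \<nu>) x)
                     (case_option (\<nu> x) (\<lambda>\<delta>. partial \<delta> \<nu> x)))
    in d \<noteq> 0 \<longrightarrow>
       (\<exists>s::real. s\<^sup>2 = A x $ \<alpha> $ \<gamma> / d \<and>
          f x = - s *\<^sub>R bracket (case_option (\<nu> x) (\<lambda>\<delta>. partial \<delta> \<nu> x)))"
proof (intro allI ballI, unfold Let_def, intro impI)
  fix \<alpha> \<gamma> x
  assume x: "x \<in> D"
  define v where "v = (\<lambda>\<delta>. partial \<delta> \<nu> x)"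
  define b where "b = bracket (case_option (\<nu> x) v)"
  let ?w = "partial \<gamma> (partial \<alpha> \<nu>) x"
  let ?rows = "case_option ?w (case_option (\<nu> x) v)"
  assume "det_of (case_option ?w (case_option (\<nu> x) (\<lambda>\<delta>. partial \<delta> \<nu> x))) \<noteq> 0"
  then have d: "det_of ?rows \<noteq> 0" by (simp add: v_def)
  have C2: "Ck_on 2 D f" "Ck_on 2 D \<nu>"
    using assms(2,3) by (auto simp: smooth_on_def)
  have diff: "f differentiable_on D" "\<nu> differentiable_on D" "partial \<delta> \<nu> differentiable_on D" for \<delta>
    using C2 by (auto simp: numeral_2_eq_2)
  have lel: "(partial \<delta> f y \<bullet> u) *\<^sub>R f y - (f y \<bullet> u) *\<^sub>R partial \<delta> f y =
      (\<Sum>\<beta>\<in>UNIV. A y $ \<delta> $ \<beta> *\<^sub>R (star_wedge ((\<lambda>\<delta>. partial \<delta> \<nu> y)(\<beta> := \<nu> y)) *v u))"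
    if "y \<in> D" for y \<delta> u
  proof -
    have "wedge (f y) (partial \<delta> f y) *v u =
      (\<Sum>\<beta>\<in>UNIV. A y $ \<delta> $ \<beta> *\<^sub>R star_wedge ((\<lambda>\<delta>. partial \<delta> \<nu> y)(\<beta> := \<nu> y))) *v u"
      using assms(8) that by (simp add: lelieuvre_related_def)
    then show ?thesis
      by (simp add: wedge_mult_vector sum_matrix_vector_mult
           scaleR_matrix_vector_assoc[symmetric])
  qed
  have "partial \<delta> f y \<bullet> \<nu> y = 0" if "y \<in> D" for y \<delta>
    using lel[OF that, of \<delta> "\<nu> y"] assms(4,6)[OF that] by (simp add: star_wedge_replace_base)
  \<comment> \<open>Proved on all of \<open>D\<close>, not just at \<open>x\<close>, because this
    identity is itself differentiated below.\<close>
  then have f_\<nu>: "f y \<bullet> partial \<delta> \<nu> y = 0" if "y \<in> D" for y \<delta>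
    using inner_partial_eq[OF assms(1) that diff(1,2) assms(6)] that by simp
  \<comment> \<open>On the left the second term drops by the previous orthogonality; on the right
    only the summand \<open>\<beta> = \<gamma>\<close> survives.\<close>
  have "(partial \<alpha> f x \<bullet> v \<gamma>) *\<^sub>R f x = - (A x $ \<alpha> $ \<gamma>) *\<^sub>R b"
    using lel[OF x, of \<alpha> "v \<gamma>"] f_\<nu>[OF x, of \<gamma>]
    unfolding v_def[symmetric] star_wedge_replace_direction
    by (simp add: v_def b_def if_distrib[of "scaleR _"] sum.delta cong: if_cong)
  \<comment> \<open>Differentiating along \<alpha> yields the derivatives in the order opposite to
    \<open>?w\<close>, so \<open>partial_commute\<close> must follow.\<close>
  moreover have "f x \<bullet> partial \<alpha> (partial \<gamma> \<nu>) x = - (partial \<alpha> f x \<bullet> v \<gamma>)"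
    unfolding v_def by (rule inner_partial_eq[OF assms(1) x diff(1,3) f_\<nu>])
  moreover have "partial \<alpha> (partial \<gamma> \<nu>) x = ?w"
    by (rule partial_commute[OF assms(1) C2(2) x])
  ultimately have key: "(f x \<bullet> ?w) *\<^sub>R f x = A x $ \<alpha> $ \<gamma> *\<^sub>R b"
    by (metis scaleR_minus_left minus_minus)
  have p: "f x \<bullet> ?w \<noteq> 0"
  proof
    assume "f x \<bullet> ?w = 0"
    then have "f x \<bullet> ?rows r = 0" for r
      using assms(6)[OF x] f_\<nu>[OF x] by (auto simp: v_def split: option.split)
    with orthogonal_to_rows_eq_0[OF d] assms(4)[OF x] show False by blast
  qed
  define c where "c = A x $ \<alpha> $ \<gamma> / (f x \<bullet> ?w)"
  have fc: "f x = c *\<^sub>R b"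
    using arg_cong[OF key, of "scaleR (inverse (f x \<bullet> ?w))"] p
    by (simp add: c_def divide_inverse mult.commute)
  have "f x \<bullet> ?w = c * (?w \<bullet> b)" by (subst fc) (simp add: inner_commute)
  also have "?w \<bullet> b = det_of ?rows"
    by (simp add: b_def inner_bracket)
  finally have pd: "f x \<bullet> ?w = c * det_of ?rows" .
  have "c * (f x \<bullet> ?w) = A x $ \<alpha> $ \<gamma>"
    using p by (simp add: c_def)
  \<comment> \<open>Inserting \<open>pd\<close> into the preceding equation gives c * c * d = A. The
    root is \<open>- c\<close> because the stated formula carries a minus sign.\<close>
  then have "(- c)\<^sup>2 = A x $ \<alpha> $ \<gamma> / det_of ?rows"
    using d by (simp add: pd field_simps power2_eq_square)
  then show "\<exists>s. s\<^sup>2 = A x $ \<alpha> $ \<gamma> / det_of (case_option ?w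
        (case_option (\<nu> x) (\<lambda>\<delta>. partial \<delta> \<nu> x))) \<and>
      f x = - s *\<^sub>R bracket (case_option (\<nu> x) (\<lambda>\<delta>. partial \<delta> \<nu> x))"
    using fc unfolding v_def b_def by (intro exI[of _ "- c"]) simp
qed

end
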